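(* Let $(G,p)$ be an $r$-dimensional tensegrity framework in $\mathbb{R}^r$ with configuration matrix $P$ and sets of bars, cables and struts $B$, $C$, $S$. Then there exists a tensegrity framework $(G,p')$ affinely-dominated by, but not congruent to, $(G,p)$ if and only if there exists a non-zero symmetric $r\times r$ matrix $\Phi$ such that $$\mathrm{trace}(F^{ij}P\Phi P^T)=0\quad\text{for all }\{i,j\}\in B,$$ $$\mathrm{trace}(F^{ij}P\Phi P^T)\le 0\quad\text{for all }\{i,j\}\in C,$$ $$\mathrm{trace}(F^{ij}P\Phi P^T)\ge 0\quad\text{for all }\{i,j\}\in S.$$
   Context: A tensegrity graph $G=(V,E)$ is a simple connected graph with $V=\{1,\ldots,n\}$ in which each edge is labelled as either a bar, a cable or a strut; $B$, $C$, $S$ denote the sets of bars, cables and struts, so $E=B\cup C\cup S$ (disjoint union). A tensegrity framework $(G,p)$ in $\mathbb{R}^r$ is a tensegrity graph $G$ together with a configuration $p=(p^1,\ldots,p^n)$ of points $p^i\in\mathbb{R}^r$. It is $r$-dimensional if $r$ is the dimension of the affine span of $p^1,\ldots,p^n$. Its configuration matrix $P$ is the $n\times r$ matrix whose $i$th row is $(p^i)^T$. $(G,q)$ is congruent to $(G,p)$ if $\|q^i-q^j\|^2=\|p^i-p^j\|^2$ for all $i,j=1,\ldots,n$. $(G,q)$ is dominated by $(G,p)$ if $\|q^i-q^j\|^2=\|p^i-p^j\|^2$ for each $\{i,j\}\in B$, $\|q^i-q^j\|^2\le\|p^i-p^j\|^2$ for each $\{i,j\}\in C$, and $\|q^i-q^j\|^2\ge\|p^i-p^j\|^2$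 for each $\{i,j\}\in S$. $(G,q)$ is affinely-dominated by $(G,p)$ if it is dominated by $(G,p)$ and there are an $r\times r$ matrix $A$ and $b\in\mathbb{R}^r$ with $q^i=Ap^i+b$ for all $i=1,\ldots,n$. $e^i$ is the $i$th standard unit vector in $\mathbb{R}^n$ and $F^{ij}=(e^i-e^j)(e^i-e^j)^T$. *)

theory Defs
  imports "HOL-Analysis.Analysis"
begin

text \<open>
  The vertex set is the whole finite type \<open>'v\<close>, so \<open>n = CARD('v)\<close>, and points live in
  \<open>real ^ 'r\<close>, so \<open>r = CARD('r)\<close>. An edge is the unordered pair of its end points.
\<close>

record 'v tensegrity =
  bars :: "'v set set"
  cables :: "'v set set"
  struts :: "'v set set"

definition edges :: "'v tensegrity \<Rightarrow> 'v set set" where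
  "edges G = bars G \<union> cables G \<union> struts G"

definition tensegrity_graph :: "('v::finite) tensegrity \<Rightarrow> bool" where
  "tensegrity_graph G \<longleftrightarrow>
     bars G \<inter> cables G = {} \<and> bars G \<inter> struts G = {} \<and> cables G \<inter> struts G = {} \<and>
     (\<forall>e\<in>edges G. card e = 2) \<and>
     (\<forall>i j. (i, j) \<in> {(u, v). {u, v} \<in> edges G}\<^sup>*)"

type_synonym ('v, 'r) configuration = "'v \<Rightarrow> real ^ 'r"

definition framework_dim :: "('v::finite, 'r::finite) configuration \<Rightarrow> int" where
  "framework_dim p = aff_dim (affine hull (range p))"

definition config_matrix :: "('v::finite, 'r::finite) configuration \<Rightarrow> real ^ 'r ^ 'v" where
  "config_matrix p = (\<chi> i. p i)"

text \<open>
  In the following three definitions the framework \<open>(G, q)\<close> is compared with \<open>(G, p)\<close>;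
  congruence involves all pairs of vertices and hence does not depend on the graph.
\<close>

definition framework_congruent ::
    "('v, 'r::finite) configuration \<Rightarrow> ('v, 'r) configuration \<Rightarrow> bool" where
  "framework_congruent q p \<longleftrightarrow> (\<forall>i j. (norm (q i - q j))\<^sup>2 = (norm (p i - p j))\<^sup>2)"

definition dominated ::
    "'v tensegrity \<Rightarrow> ('v, 'r::finite) configuration \<Rightarrow> ('v, 'r) configuration \<Rightarrow> bool" where
  "dominated G q p \<longleftrightarrow>
     (\<forall>i j. {i, j} \<in> bars G \<longrightarrow> (norm (q i - q j))\<^sup>2 = (norm (p i - p j))\<^sup>2) \<and>
     (\<forall>i j. {i, j} \<in> cables G \<longrightarrow> (norm (q i - q j))\<^sup>2 \<le> (norm (p i - p j))\<^sup>2) \<and>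
     (\<forall>i j. {i, j} \<in> struts G \<longrightarrow> (norm (q i - q j))\<^sup>2 \<ge> (norm (p i - p j))\<^sup>2)"

definition affinely_dominated ::
    "'v tensegrity \<Rightarrow> ('v, 'r::finite) configuration \<Rightarrow> ('v, 'r) configuration \<Rightarrow> bool" where
  "affinely_dominated G q p \<longleftrightarrow>
     dominated G q p \<and>
     (\<exists>(A :: real ^ 'r ^ 'r) (b :: real ^ 'r). \<forall>i. q i = A *v p i + b)"

definition F_mat :: "'v \<Rightarrow> 'v \<Rightarrow> real ^ 'v ^ ('v::finite)" where
  "F_mat i j =
     (columnvector (axis i 1 - axis j 1) :: real ^ 1 ^ 'v) **
     (rowvector (axis i 1 - axis j 1) :: real ^ 'v ^ 1)"

end

theory Submission
  imports Defs
begin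

text \<open>
  Put \<open>\<Phi> = A\<^sup>T A - I\<close>: for the affine image \<open>q\<^sup>i = A p\<^sup>i + b\<close> the quantity
  \<open>trace (F\<^sup>i\<^sup>j P \<Phi> P\<^sup>T) = (p\<^sup>i - p\<^sup>j)\<^sup>T \<Phi> (p\<^sup>i - p\<^sup>j)\<close> is the change of the squared distance
  between vertices \<open>i\<close> and \<open>j\<close>. Conversely, for small \<open>\<epsilon> > 0\<close> the matrix \<open>I + \<epsilon> \<Phi>\<close> has a symmetric
  square root \<open>A = I + Y\<close>, with \<open>Y\<close> the fixed point of the contraction \<open>Y \<mapsto> (\<epsilon> \<Phi> - Y\<^sup>2) / 2\<close>. The
  resulting framework is congruent to the given one only if the quadratic form of \<open>\<Phi>\<close> vanishes on
  all differences \<open>p\<^sup>i - p\<^sup>j\<close>; by polarization and full dimension this forces \<open>\<Phi> = 0\<close>.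
\<close>

lemma matrix_add_rdistrib: "(A + B) ** C = A ** C + B ** (C :: 'a::semiring_1 ^ 'k ^ 'm)"
  by (simp add: matrix_matrix_mult_def vec_eq_iff distrib_right sum.distrib)

lemma matrix_diff_ldistrib: "A ** (B - C) = A ** B - A ** (C :: 'a::ring_1 ^ 'k ^ 'm)"
  by (simp add: matrix_matrix_mult_def vec_eq_iff right_diff_distrib sum_subtractf)

lemma matrix_diff_rdistrib: "(A - B) ** C = A ** C - B ** (C :: 'a::ring_1 ^ 'k ^ 'm)"
  by (simp add: matrix_matrix_mult_def vec_eq_iff left_diff_distrib sum_subtractf)

text \<open>Supplies the constant \<open>K\<close> with
  \<open>norm (X ** Y) \<le> norm X * norm Y * K\<close> that drives the contraction estimate; in
  finite dimension bilinearity suffices.\<close>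

lemma bounded_bilinear_matrix_matrix_mult:
  "bounded_bilinear ((**) :: real ^ 'm ^ 'n \<Rightarrow> real ^ 'k ^ 'm \<Rightarrow> real ^ 'k ^ 'n)"
  unfolding bilinear_conv_bounded_bilinear [symmetric] bilinear_def linear_iff
  by (simp add: matrix_add_ldistrib matrix_add_rdistrib matrix_scalar_ac scalar_matrix_assoc)

lemma transpose_add: "transpose (A + B) = transpose A + transpose (B :: 'a::plus ^ 'n ^ 'm)"
  by (simp add: transpose_def vec_eq_iff)

lemma transpose_diff: "transpose (A - B) = transpose A - transpose (B :: 'a::minus ^ 'n ^ 'm)"
  by (simp add: transpose_def vec_eq_iff)

lemma continuous_on_transpose:
  "continuous_on S (transpose :: real ^ 'n ^ 'm \<Rightarrow> real ^ 'm ^ 'n)"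
  unfolding transpose_def by (intro continuous_intros)

lemma gram_factor_near_identity:
  fixes \<Phi> :: "real ^ 'n ^ 'n"
  assumes sym: "transpose \<Phi> = \<Phi>"
  obtains \<epsilon> and A :: "real ^ 'n ^ 'n" where "\<epsilon> > 0" "transpose A ** A = mat 1 + \<epsilon> *\<^sub>R \<Phi>"
proof -
  obtain K where K: "K > 0"
      "\<And>(X :: real ^ 'n ^ 'n) (Y :: real ^ 'n ^ 'n). norm (X ** Y) \<le> norm X * norm Y * K"
    using bounded_bilinear.pos_bounded [OF bounded_bilinear_matrix_matrix_mult]
    by metis
  \<comment> \<open>With this radius, squaring has Lipschitz constant
    \<open>2 * \<delta> * K = 1\<close> on the ball, so the factor 1/2 in \<open>f\<close> makes
    \<open>f\<close> a contraction.\<close>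
  define \<delta> where "\<delta> = 1 / (2 * K)"
  \<comment> \<open>Small enough that \<open>\<epsilon> *\<^sub>R \<Phi>\<close> has norm at most
    \<open>\<delta>\<close>; the added 1 covers \<open>\<Phi> = 0\<close>.\<close>
  define \<epsilon> where "\<epsilon> = \<delta> / (norm \<Phi> + 1)"
  have \<delta>: "\<delta> > 0" "\<delta> * K = 1 / 2"
    using K by (simp_all add: \<delta>_def)
  have \<epsilon>: "\<epsilon> > 0" "\<epsilon> * norm \<Phi> \<le> \<delta>"
    using \<delta> by (simp_all add: \<epsilon>_def field_simps add_pos_nonneg)
  \<comment> \<open>Symmetry is built into the complete set, so the fixed point inherits it and
    \<open>transpose A ** A\<close> becomes the square of \<open>A\<close>.\<close>
  define S where "S = {Y :: real ^ 'n ^ 'n. transpose Y = Y} \<inter> cball 0 \<delta>"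
  define f where "f Y = (1/2) *\<^sub>R (\<epsilon> *\<^sub>R \<Phi> - Y ** Y)" for Y
  have "closed S"
    unfolding S_def
    by (intro closed_Int closed_cball closed_Collect_eq continuous_on_transpose continuous_on_id)
  then have complete: "complete S"
    by (simp add: complete_eq_closed)
  have "0 \<in> S"
    using \<delta> by (simp add: S_def transpose_def vec_eq_iff)
  then have nonempty: "S \<noteq> {}"
    by blast
  have maps: "f ` S \<subseteq> S"
  proof clarify
    fix Y assume Y: "Y \<in> S"
    then have Y': "norm Y \<le> \<delta>" "transpose Y = Y"
      by (auto simp: S_def)
    have "norm (Y ** Y) \<le> norm Y * norm Y * K"
      by (rule K)
    also have "\<dots> \<le> \<delta> * \<delta> * K"
      using Y' K \<delta> by (intro mult_right_mono mult_mono) auto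
    also have "\<dots> \<le> \<delta>"
      using \<delta> by (simp add: mult.assoc)
    finally have "norm (\<epsilon> *\<^sub>R \<Phi> - Y ** Y) \<le> \<delta> + \<delta>"
      using \<epsilon> norm_triangle_ineq4 [of "\<epsilon> *\<^sub>R \<Phi>" "Y ** Y"] by simp
    then show "f Y \<in> S"
      by (simp add: S_def f_def transpose_diff transpose_scalar matrix_transpose_mul sym Y')
  qed
  have contraction: "dist (f Y) (f Z) \<le> (1/2) * dist Y Z" if "Y \<in> S \<and> Z \<in> S" for Y Z
  proof -
    have YZ: "norm Y \<le> \<delta>" "norm Z \<le> \<delta>"
      using that by (auto simp: S_def)
    \<comment> \<open>The noncommutative difference of squares: the mixed term \<open>Y ** Z\<close>
      cancels.\<close>
    have "norm (Y ** Y - Z ** Z) = norm (Y ** (Y - Z) + (Y - Z) ** Z)"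
      by (simp add: matrix_diff_rdistrib matrix_diff_ldistrib)
    also have "\<dots> \<le> norm Y * norm (Y - Z) * K + norm (Y - Z) * norm Z * K"
      by (intro norm_triangle_le add_mono K)
    also have "\<dots> \<le> \<delta> * norm (Y - Z) * K + norm (Y - Z) * \<delta> * K"
      using YZ K by (intro add_mono mult_right_mono mult_left_mono) auto
    also have "\<dots> = 2 * (\<delta> * K) * norm (Y - Z)"
      by simp
    finally have "norm (Y ** Y - Z ** Z) \<le> norm (Y - Z)"
      by (simp add: \<delta>)
    moreover have "f Y - f Z = (1/2) *\<^sub>R (Z ** Z - Y ** Y)"
      by (simp add: f_def algebra_simps)
    ultimately show ?thesis
      by (simp add: dist_norm norm_minus_commute)
  qed
  obtain Y where Y: "Y \<in> S" "f Y = Y"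
    using Banach_fix [OF complete nonempty _ _ maps, of "1 / 2"] contraction by auto
  have "2 *\<^sub>R f Y = \<epsilon> *\<^sub>R \<Phi> - Y ** Y"
    by (simp add: f_def)
  then have "(mat 1 + Y) ** (mat 1 + Y) = mat 1 + \<epsilon> *\<^sub>R \<Phi>"
    by (simp add: Y(2) matrix_add_rdistrib matrix_add_ldistrib scaleR_2 algebra_simps)
  moreover have "transpose (mat 1 + Y) = mat 1 + Y"
    using Y(1) by (simp add: S_def transpose_add transpose_mat)
  ultimately show ?thesis
    using that [OF \<epsilon>(1), of "mat 1 + Y"] by simp
qed

text \<open>Cyclicity of the trace for a rank-one factor, obtained by swapping the two sums.\<close>

lemma trace_columnvector_rowvector_mult:
  fixes x y :: "real ^ 'n" and M :: "real ^ 'n ^ 'n"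
  shows "trace ((columnvector x :: real ^ 1 ^ 'n) ** (rowvector y :: real ^ 'n ^ 1) ** M) 
    = y \<bullet> (M *v x)"
proof -
  have "trace ((columnvector x :: real ^ 1 ^ 'n) ** (rowvector y :: real ^ 'n ^ 1) ** M)
      = (\<Sum>i\<in>UNIV. \<Sum>k\<in>UNIV. x $ i * y $ k * M $ k $ i)"
    by (simp add: trace_def matrix_matrix_mult_def columnvector_def rowvector_def)
  also have "\<dots> = (\<Sum>k\<in>UNIV. \<Sum>i\<in>UNIV. x $ i * y $ k * M $ k $ i)"
    by (rule sum.swap)
  also have "\<dots> = y \<bullet> (M *v x)"
    by (simp add: inner_vec_def matrix_vector_mult_def sum_distrib_left mult_ac)
  finally show ?thesis .
qed

text \<open>\<open>F_mat i j\<close> is the rank-one matrix of \<open>axis i 1 - axis j 1\<close>,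
  and the transposed configuration matrix sends this vector to \<open>p i - p j\<close>.\<close>

lemma trace_F_mat:
  fixes p :: "('v::finite, 'r::finite) configuration" and \<Phi> :: "real ^ 'r ^ 'r"
  shows "trace (F_mat i j ** config_matrix p ** \<Phi> ** transpose (config_matrix p))
    = (p i - p j) \<bullet> (\<Phi> *v (p i - p j))"
proof -
  let ?P = "config_matrix p" and ?e = "axis i 1 - axis j 1 :: real ^ 'v"
  have row: "transpose ?P *v ?e = p i - p j"
    by (simp add: matrix_vector_mult_diff_distrib matrix_vector_mul_component vec_eq_iff
        matrix_vector_mult_basis column_def transpose_def config_matrix_def)
  have "trace (F_mat i j ** ?P ** \<Phi> ** transpose ?P) = ?e \<bullet> ((?P ** \<Phi> ** transpose ?P) *v ?e)"
    unfolding F_mat_def trace_columnvector_rowvector_mult [symmetric] by (simp add: matrix_mul_assoc)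
  also have "\<dots> = ?e \<bullet> (?P *v (\<Phi> *v (transpose ?P *v ?e)))"
    by (simp only: matrix_vector_mul_assoc matrix_mul_assoc)
  also have "\<dots> = (transpose ?P *v ?e) \<bullet> (\<Phi> *v (transpose ?P *v ?e))"
    by (simp only: dot_lmul_matrix [symmetric] transpose_matrix_vector)
  finally show ?thesis
    by (simp only: row)
qed

text \<open>The matrix \<open>transpose A ** A - mat 1\<close> measures how far \<open>A\<close> is
  from being an isometry. Both directions of the theorem read off the change of squared lengths from
  it.\<close>

lemma norm_matrix_vector_mult_sq:
  fixes A :: "real ^ 'n ^ 'm"
  shows "(norm (A *v x))\<^sup>2 = (norm x)\<^sup>2 + x \<bullet> ((transpose A ** A - mat 1) *v x)"
proof -
  have "x \<bullet> ((transpose A ** A) *v x) = (A *v x) \<bullet> (A *v x)"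
    by (metis dot_lmul_matrix matrix_vector_mul_assoc vector_transpose_matrix)
  then show ?thesis
    by (simp only: power2_norm_eq_inner matrix_vector_mult_diff_rdistrib inner_diff_right
        matrix_vector_mul_lid)
qed

text \<open>Translating by \<open>- p k\<close> moves a point of the affine hull to the origin, so
  affine dimension becomes linear dimension.\<close>

lemma span_differences_eq_UNIV:
  fixes p :: "('v::finite, 'r::finite) configuration"
  assumes "framework_dim p = int CARD('r)"
  shows "span (range (\<lambda>i. p i - p k)) = UNIV"
proof -
  have "int (dim ((+) (- p k) ` range p)) = aff_dim (range p)"
    by (intro aff_dim_eq_dim [symmetric] hull_inc) simp
  also have "\<dots> = int DIM(real ^ 'r)"
    using assms by (simp add: framework_dim_def)
  finally have "dim (range (\<lambda>i. p i - p k)) = DIM(real ^ 'r)"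
    by (simp add: image_image)
  then show ?thesis
    by (rule dim_eq_full [THEN iffD1])
qed

lemma symmetric_form_zero_on_differences:
  fixes p :: "('v::finite, 'r::finite) configuration" and \<Phi> :: "real ^ 'r ^ 'r"
  assumes dim: "framework_dim p = int CARD('r)"
    and sym: "transpose \<Phi> = \<Phi>"
    and zero: "\<And>i j. (p i - p j) \<bullet> (\<Phi> *v (p i - p j)) = 0"
  shows "\<Phi> = 0"
proof -
  fix k :: 'v
  let ?D = "range (\<lambda>i. p i - p k)"
  have sym': "y \<bullet> (\<Phi> *v x) = x \<bullet> (\<Phi> *v y)" for x y
    by (metis dot_lmul_matrix inner_commute sym transpose_matrix_vector)
  have base: "x \<bullet> (\<Phi> *v y) = 0" if "x \<in> ?D" "y \<in> ?D" for x y
  proof -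
    from that obtain i j where ij: "x = p i - p k" "y = p j - p k"
      by blast
    \<comment> \<open>Since \<open>x - y = p i - p j\<close> no longer involves \<open>k\<close>,
      the hypothesis applies to all three vectors, and polarization yields the mixed term.\<close>
    have "(x - y) \<bullet> (\<Phi> *v (x - y)) = 0" "x \<bullet> (\<Phi> *v x) = 0" "y \<bullet> (\<Phi> *v y) = 0"
      using zero [of i j] zero [of i k] zero [of j k] by (simp_all add: ij)
    then show ?thesis
      using sym' [of x y] by (simp add: matrix_vector_mult_diff_distrib inner_diff_left inner_diff_right)
  qed
  \<comment> \<open>The vanishing extends by linearity over the spanning set, first in the left
    argument and then in the right one.\<close>
  have "x \<bullet> (\<Phi> *v y) = 0" if "y \<in> ?D" for x y
  proof -
    have "x \<in> span ?D"
      by (simp add: span_differences_eq_UNIV [OF dim])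
    then show ?thesis
      using that by (induction rule: span_induct_alt) (simp_all add: inner_add_left base)
  qed
  then have ker: "\<Phi> *v y = 0" if "y \<in> ?D" for y
    using that by (metis inner_eq_zero_iff)
  have "\<Phi> *v y = 0" for y
  proof -
    have "y \<in> span ?D"
      by (simp add: span_differences_eq_UNIV [OF dim])
    then show ?thesis
      by (induction rule: span_induct_alt)
        (simp_all add: matrix_vector_right_distrib matrix_vector_mult_scaleR ker)
  qed
  then show ?thesis
    by (metis matrix_eq matrix_vector_mult_0)
qed

theorem lemma5p1:
  fixes G :: "('v::finite) tensegrity"
    and p :: "('v, 'r::finite) configuration"
    and P :: "real ^ 'r ^ 'v"
  assumes "tensegrity_graph G"
    and "framework_dim p = int CARD('r)"
    and "P = config_matrix p"
  shows "(\<exists>p' :: ('v, 'r) configuration. affinely_dominated G p' p \<and> \<not> framework_congruent p' p) \<longleftrightarrow>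
    (\<exists>\<Phi> :: real ^ 'r ^ 'r. \<Phi> \<noteq> 0 \<and> transpose \<Phi> = \<Phi> \<and>
       (\<forall>i j. {i, j} \<in> bars G \<longrightarrow> trace (F_mat i j ** P ** \<Phi> ** transpose P) = 0) \<and>
       (\<forall>i j. {i, j} \<in> cables G \<longrightarrow> trace (F_mat i j ** P ** \<Phi> ** transpose P) \<le> 0) \<and>
       (\<forall>i j. {i, j} \<in> struts G \<longrightarrow> trace (F_mat i j ** P ** \<Phi> ** transpose P) \<ge> 0))"
  (is "?L \<longleftrightarrow> (\<exists>\<Phi>. ?R \<Phi>)")
proof
  assume ?L
  then obtain p' A b where dom: "dominated G p' p" and p': "\<And>i. p' i = A *v p i + b"
    and ncong: "\<not> framework_congruent p' p"
    by (auto simp: affinely_dominated_def)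
  let ?\<Phi> = "transpose A ** A - mat 1"
  have change: "(norm (p' i - p' j))\<^sup>2 = (norm (p i - p j))\<^sup>2 +
    (p i - p j) \<bullet> (?\<Phi> *v (p i - p j))" for i j
    unfolding norm_matrix_vector_mult_sq [symmetric] p' by (simp add: matrix_vector_mult_diff_distrib)
  \<comment> \<open>If this matrix were zero, \<open>change\<close> would preserve all distances.
    Removing \<open>right_minus_eq\<close> keeps the assumed equation in the form that rewrites
    \<open>change\<close>.\<close>
  have "?\<Phi> \<noteq> 0"
    using ncong by (auto simp: framework_congruent_def change simp del: right_minus_eq)
  moreover have "transpose ?\<Phi> = ?\<Phi>"
    by (simp add: transpose_diff matrix_transpose_mul transpose_mat)
  ultimately have "?R ?\<Phi>"
    using dom by (simp add: dominated_def change assms(3) trace_F_mat)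
  then show "\<exists>\<Phi>. ?R \<Phi>" ..
next
  assume "\<exists>\<Phi>. ?R \<Phi>"
  then obtain \<Phi> where \<Phi>: "?R \<Phi>" ..
  then obtain \<epsilon> and A :: "real ^ 'r ^ 'r" where \<epsilon>: "\<epsilon> > 0"
    and A: "transpose A ** A = mat 1 + \<epsilon> *\<^sub>R \<Phi>"
    by (metis gram_factor_near_identity)
  \<comment> \<open>A linear image suffices: distances ignore translations, so
    \<open>b = 0\<close>.\<close>
  define p' where "p' i = A *v p i" for i
  have change: "(norm (p' i - p' j))\<^sup>2 = (norm (p i - p j))\<^sup>2 +
    \<epsilon> * ((p i - p j) \<bullet> (\<Phi> *v (p i - p j)))" for i j
    using norm_matrix_vector_mult_sq [of A "p i - p j"]
    by (simp add: p'_def A matrix_vector_mult_diff_distrib [symmetric] scaleR_matrix_vector_assoc [symmetric])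
  have "dominated G p' p"
    using \<Phi> \<epsilon> by (simp add: dominated_def change assms(3) trace_F_mat mult_le_0_iff zero_le_mult_iff)
  then have "affinely_dominated G p' p"
    unfolding affinely_dominated_def p'_def by (metis add.right_neutral)
  moreover have "\<not> framework_congruent p' p"
    using \<Phi> \<epsilon> symmetric_form_zero_on_differences [OF assms(2), of \<Phi>]
    by (auto simp: framework_congruent_def change)
  ultimately show ?L
    by blast
qed

end
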